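(* Let $$V=\sum_{i=1}^n|\phi_{\lambda_i}|^2,\qquad \widetilde V=\sum_{i=1}^n|P_N\phi_{\lambda_i}|^2,$$ and assume that the principal eigenfunctions $\{\phi_{\lambda_i}\}_{i=1}^n$ are analytic over $\mathbb{D}^n(S)$. If $|P_N\phi^R_{\lambda_i}|<M_i$ and $|P_N\phi^I_{\lambda_i}|<K_i$ with $K_i,M_i>0$ for all $i=1,\dots,n$, then $$|\dot V-\dot{\widetilde V}|<2\sum_{i=1}^n\Big(|\lambda_i^R|\,B_i(N)+M_i\,\big|(P_N-I)\mathcal{L}P_N\phi^R_{\lambda_i}\big|+K_i\,\big|(P_N-I)\mathcal{L}P_N\phi^I_{\lambda_i}\big|\Big),$$ where $$B_i(N)=2|P_N\phi_{\lambda_i}|\,|\phi_{\lambda_i}-P_N\phi_{\lambda_i}|+|\phi_{\lambda_i}-P_N\phi_{\lambda_i}|^2 .$$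
   Context: Setting: $\dot x=F(x)$, $x\in\mathbb{X}$, where $\mathbb{X}\subset\mathbb{R}^n$ is compact and the vector field $F$ is analytic and Lipschitz continuous, with flow map $\varphi^t:\mathbb{X}\to\mathbb{X}$, $t\ge0$. The origin is a locally stable hyperbolic equilibrium, so that the eigenvalues $\lambda_1,\dots,\lambda_n$ of the Jacobian matrix $\mathbf{J}_F(0)$ of $F$ at $0$ have strictly negative real part, and these eigenvalues are non-resonant. $\mathcal{L}f=F\cdot\nabla f$ is the infinitesimal generator of the Koopman semigroup $f\mapsto f\circ\varphi^t$. The $n$ principal eigenfunctions $\phi_{\lambda_i}$ are the (possibly complex-valued) eigenfunctions of $\mathcal{L}$ associated with the eigenvalues $\lambda_i$ of $\mathbf{J}_F(0)$: $\mathcal{L}\phi_{\lambda_i}=\lambda_i\phi_{\lambda_i}$. Notation: $\mathbb{D}^n(S)=\{x\in\mathbb{R}^n:|x_i|<S\ \forall i\}$ with $S>0$. For $N\in\mathbb{N}$, $P_N$ is the truncation operator that keeps the monomials $x_1^{k_1}\cdots x_n^{k_n}$ with $\sum_i k_i\le N$ and sends all others to $0$, so that $P_Nf$ is the Taylor expansion of an analytic function $f$ at the origin truncated at total degree $N$. $I$ is the identity. $\phi^R_{\lambda_i}=\Re(\phi_{\lambda_i})$, $\phi^I_{\lambda_i}=\Im(\phi_{\lambda_i})$, $\lambda_i^R=\Re(\lambda_i)$. For a function $W$, $\dot W=\mathcal{L}W=F\cdot\nabla W$ is its derivative along the trajectories of $\dot x=F(x)$. The inequalities are between functions of $x$, read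 pointwise.
   Formalization: The strict inequality fails at x=0 (both sides vanish), and everywhere for F(x)=-x, φ(x)=x, N≥1. Proved instead: ≤ at every x, and < wherever some (P_N-I)LP_Nφ^R_{λ_i} or (P_N-I)LP_Nφ^I_{λ_i} is nonzero. *)

theory Defs
  imports "HOL-Analysis.Analysis"
begin

definition cube :: "real \<Rightarrow> (real ^ 'n) set" where
  "cube S = {x. \<forall>i. \<bar>x $ i\<bar> < S}"

definition monomial :: "('n \<Rightarrow> nat) \<Rightarrow> real ^ 'n \<Rightarrow> real" where
  "monomial k x = (\<Prod>i\<in>UNIV. (x $ i) ^ k i)"

definition has_power_series_at ::
    "(real ^ 'n \<Rightarrow> 'b::real_normed_vector) \<Rightarrow> (('n \<Rightarrow> nat) \<Rightarrow> 'b) \<Rightarrow> real ^ 'n \<Rightarrow> bool" where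
  "has_power_series_at f c a \<longleftrightarrow>
     (\<exists>r>0. \<forall>h\<in>cube r. ((\<lambda>k. monomial k h *\<^sub>R c k) has_sum f (a + h)) UNIV)"

definition real_analytic_on :: "(real ^ 'n \<Rightarrow> 'b::real_normed_vector) \<Rightarrow> (real ^ 'n) set \<Rightarrow> bool" where
  "real_analytic_on f A \<longleftrightarrow> (\<forall>a\<in>A. \<exists>c. has_power_series_at f c a)"

(* The coefficients at the origin; unique whenever f is analytic at the origin. *)
definition taylor_coeffs :: "(real ^ 'n \<Rightarrow> 'b::real_normed_vector) \<Rightarrow> ('n \<Rightarrow> nat) \<Rightarrow> 'b" where
  "taylor_coeffs f = (THE c. has_power_series_at f c 0)"

definition taylor_trunc ::
    "nat \<Rightarrow> (real ^ 'n \<Rightarrow> 'b::real_normed_vector) \<Rightarrow> real ^ 'n \<Rightarrow> 'b" where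
  "taylor_trunc N f x =
     (\<Sum>k\<in>{k. (\<Sum>i\<in>UNIV. k i) \<le> N}. monomial k x *\<^sub>R taylor_coeffs f k)"

(* F . grad f, the derivative of f at x in the direction F x; meaningful where f is differentiable. *)
definition koopman_generator ::
    "(real ^ 'n \<Rightarrow> real ^ 'n) \<Rightarrow> (real ^ 'n \<Rightarrow> 'b::real_normed_vector) \<Rightarrow> real ^ 'n \<Rightarrow> 'b" where
  "koopman_generator F f x = frechet_derivative f (at x) (F x)"

definition semiflow_on ::
    "(real ^ 'n) set \<Rightarrow> (real ^ 'n \<Rightarrow> real ^ 'n) \<Rightarrow> (real \<Rightarrow> real ^ 'n \<Rightarrow> real ^ 'n) \<Rightarrow> bool" where
  "semiflow_on X F flow \<longleftrightarrow>
     (\<forall>x\<in>X. flow 0 x = x \<and>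
        (\<forall>t\<ge>0. flow t x \<in> X \<and>
           ((\<lambda>s. flow s x) has_vector_derivative F (flow t x)) (at t within {0..})))"

(* lam lists all complex eigenvalues with algebraic multiplicity: the characteristic
   polynomial of J splits as the product of the factors z - lam i. *)
definition eigenvalues_of :: "real ^ 'n ^ 'n \<Rightarrow> ('n \<Rightarrow> complex) \<Rightarrow> bool" where
  "eigenvalues_of J lam \<longleftrightarrow>
     (\<forall>z. det (mat z - (\<chi> i j. complex_of_real (J $ i $ j))) = (\<Prod>i\<in>UNIV. z - lam i))"

definition nonresonant :: "('n::finite \<Rightarrow> complex) \<Rightarrow> bool" where
  "nonresonant lam \<longleftrightarrow>
     (\<forall>j k. (\<Sum>i\<in>UNIV. k i) \<ge> 2 \<longrightarrow> lam j \<noteq> (\<Sum>i\<in>UNIV. of_nat (k i) * lam i))"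

definition sum_sq :: "('n::finite \<Rightarrow> 'a \<Rightarrow> complex) \<Rightarrow> 'a \<Rightarrow> real" where
  "sum_sq phi x = (\<Sum>i\<in>UNIV. (cmod (phi i x))\<^sup>2)"

definition trunc_bound :: "nat \<Rightarrow> (real ^ 'n \<Rightarrow> complex) \<Rightarrow> real ^ 'n \<Rightarrow> real" where
  "trunc_bound N phi x =
     2 * cmod (taylor_trunc N phi x) * cmod (phi x - taylor_trunc N phi x)
     + (cmod (phi x - taylor_trunc N phi x))\<^sup>2"

(* (P_N - I) L P_N g.  The estimate on the derivatives of the two candidate functions is strict
   wherever one of these remainders is nonzero.  It cannot be strict everywhere: at the
   equilibrium both sides vanish, and for linear F with N \<ge> 1 both sides vanish identically. *)
definition generator_remainder ::
    "nat \<Rightarrow> (real ^ 'n \<Rightarrow> real ^ 'n) \<Rightarrow> (real ^ 'n \<Rightarrow> real) \<Rightarrow> real ^ 'n \<Rightarrow> real" where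
  "generator_remainder N F g x =
     taylor_trunc N (koopman_generator F (taylor_trunc N g)) x
     - koopman_generator F (taylor_trunc N g) x"

end

theory Submission
  imports Defs "HOL-Library.Landau_Symbols"
begin

text \<open>Write \<open>\<phi> = u + \<i> v\<close> and \<open>p = P\<^sub>N \<phi>\<close>. As \<open>F\<close> vanishes at the origin, \<open>L\<close> does not lower the order of
  vanishing there, so \<open>P\<^sub>N L P\<^sub>N \<phi> = P\<^sub>N L \<phi> = \<lambda> p\<close>. Splitting \<open>L P\<^sub>N = P\<^sub>N L P\<^sub>N - (P\<^sub>N - I) L P\<^sub>N\<close> gives
  \<open>L \<bar>p\<bar>\<^sup>2 = 2 (Re \<lambda> \<bar>p\<bar>\<^sup>2 - P\<^sub>N u \<cdot> (P\<^sub>N - I) L P\<^sub>N u - P\<^sub>N v \<cdot> (P\<^sub>N - I) L P\<^sub>N v)\<close>, to be compared with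
  \<open>L \<bar>\<phi>\<bar>\<^sup>2 = 2 Re \<lambda> \<bar>\<phi>\<bar>\<^sup>2\<close>.\<close>

subsection \<open>Power series and their remainders\<close>

abbreviation deg :: "('n::finite \<Rightarrow> nat) \<Rightarrow> nat" where
  "deg k \<equiv> \<Sum>i\<in>UNIV. k i"

lemma finite_deg_le: "finite {k :: 'n::finite \<Rightarrow> nat. deg k \<le> N}"
proof (rule finite_subset)
  show "{k :: 'n \<Rightarrow> nat. deg k \<le> N} \<subseteq> {k. \<forall>i. (i \<in> UNIV \<longrightarrow> k i \<in> {..N}) \<and> (i \<notin> UNIV \<longrightarrow> k i = 0)}"
  proof (rule subsetI)
    fix k :: "'n \<Rightarrow> nat"
    assume "k \<in> {k. deg k \<le> N}"
    then have "k i \<le> N" for i using member_le_sum[of i UNIV k] by simp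
    then show "k \<in> {k. \<forall>i. (i \<in> UNIV \<longrightarrow> k i \<in> {..N}) \<and> (i \<notin> UNIV \<longrightarrow> k i = 0)}" by simp
  qed
  show "finite {k. \<forall>i. (i \<in> (UNIV :: 'n set) \<longrightarrow> k i \<in> {..N}) \<and> (i \<notin> UNIV \<longrightarrow> k i = 0)}"
    by (rule finite_set_of_finite_funs) auto
qed

lemma norm_less_imp_mem_cube:
  fixes h :: "real ^ 'n"
  assumes "norm h < r"
  shows "h \<in> cube r"
  using assms component_le_norm_cart[of h] unfolding cube_def by (auto intro: le_less_trans)

lemma open_cube: "open (cube r :: (real ^ 'n) set)"
proof -
  have "cube r = (\<Inter>i\<in>UNIV. {x :: real ^ 'n. \<bar>x $ i\<bar> < r})"
    by (auto simp: cube_def)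
  moreover have "open {x :: real ^ 'n. \<bar>x $ i\<bar> < r}" for i
    by (intro open_Collect_less continuous_intros)
  ultimately show ?thesis by auto
qed

section \<open>Lipschitz bounds for monomials and tails of power series\<close>

lemma monomial_const: "monomial k (\<chi> i. s) = s ^ deg k"
  by (simp add: monomial_def power_sum)

lemma monomial_scale:
  fixes \<rho> :: real
  assumes "\<rho> \<noteq> 0"
  shows "monomial k h = \<rho> ^ deg k * (\<Prod>i\<in>UNIV. (h $ i / \<rho>) ^ k i)"
proof -
  have "(h $ i) ^ k i = \<rho> ^ k i * (h $ i / \<rho>) ^ k i" for i
    using assms by (simp add: power_divide)
  then show ?thesis by (simp add: monomial_def power_sum prod.distrib)
qed

lemma monomial_zero: "monomial k 0 = (if deg k = 0 then 1 else 0)"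
  by (auto simp: monomial_def)

text \<open>After scaling by \<open>\<rho>\<close> all factors have modulus at most 1. There a
  difference of products is bounded by the sum of the differences of the factors, and taking the
  power \<open>k i\<close> is Lipschitz with constant \<open>k i\<close>.\<close>

lemma monomial_Lipschitz:
  fixes h h' :: "real ^ 'n" and \<rho> :: real
  assumes "norm h \<le> \<rho>" "norm h' \<le> \<rho>"
  shows "\<bar>monomial k h - monomial k h'\<bar> \<le> real (deg k) * \<rho> ^ (deg k - 1) * norm (h - h')"
proof (cases "\<rho> > 0 \<and> deg k > 0")
  case False
  then consider "\<rho> \<le> 0" | "deg k = 0" by linarith
  then show ?thesis
  proof cases
    case 1
    then have "norm h = 0" "norm h' = 0"
      using assms norm_ge_zero[of h] norm_ge_zero[of h'] by linarith+
    then show ?thesis by simp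
  qed (simp add: monomial_def)
next
  case True
  then have \<rho>: "\<rho> > 0" and k: "deg k > 0" by auto
  have scaled: "norm (x $ i / \<rho>) \<le> 1" if "norm x \<le> \<rho>" for x :: "real ^ 'n" and i
    using that component_le_norm_cart[of x i] \<rho> by (simp add: divide_le_eq)
  have "\<bar>(\<Prod>i\<in>UNIV. (h $ i / \<rho>) ^ k i) - (\<Prod>i\<in>UNIV. (h' $ i / \<rho>) ^ k i)\<bar>
      \<le> (\<Sum>i\<in>UNIV. \<bar>(h $ i / \<rho>) ^ k i - (h' $ i / \<rho>) ^ k i\<bar>)"
    unfolding real_norm_def[symmetric]
    by (rule norm_prod_diff) (unfold norm_power, (intro power_le_one norm_ge_zero scaled assms)+)
  also have "\<dots> \<le> (\<Sum>i\<in>UNIV. real (k i) * (norm (h - h') / \<rho>))"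
  proof (rule sum_mono)
    fix i
    have "\<bar>(h $ i / \<rho>) ^ k i - (h' $ i / \<rho>) ^ k i\<bar> \<le> real (k i) * \<bar>h $ i / \<rho> - h' $ i / \<rho>\<bar>"
      using norm_power_diff[OF scaled[OF assms(1)] scaled[OF assms(2)]] by (simp only: real_norm_def)
    also have "\<bar>h $ i / \<rho> - h' $ i / \<rho>\<bar> \<le> norm (h - h') / \<rho>"
      using component_le_norm_cart[of "h - h'" i] \<rho>
      unfolding diff_divide_distrib[symmetric] abs_divide by (simp add: divide_right_mono)
    finally show "\<bar>(h $ i / \<rho>) ^ k i - (h' $ i / \<rho>) ^ k i\<bar> \<le> real (k i) * (norm (h - h') / \<rho>)"
      by (simp add: mult_left_mono)
  qed
  finally have *: "\<bar>(\<Prod>i\<in>UNIV. (h $ i / \<rho>) ^ k i) - (\<Prod>i\<in>UNIV. (h' $ i / \<rho>) ^ k i)\<bar>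
      \<le> real (deg k) * (norm (h - h') / \<rho>)"
    by (simp only: of_nat_sum sum_distrib_right)
  have "\<bar>monomial k h - monomial k h'\<bar>
      = \<rho> ^ deg k * \<bar>(\<Prod>i\<in>UNIV. (h $ i / \<rho>) ^ k i) - (\<Prod>i\<in>UNIV. (h' $ i / \<rho>) ^ k i)\<bar>"
    unfolding monomial_scale[OF less_imp_neq[OF \<rho>, symmetric], of k] right_diff_distrib[symmetric] abs_mult
    using \<rho> by simp
  also have "\<dots> \<le> \<rho> ^ deg k * (real (deg k) * (norm (h - h') / \<rho>))"
    using * \<rho> by (intro mult_left_mono) auto
  also have "\<dots> = real (deg k) * \<rho> ^ (deg k - 1) * norm (h - h')"
    using \<rho> power_minus_mult[OF k, of \<rho>] by (simp add: field_simps)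
  finally show ?thesis .
qed

text \<open>Summability over an unordered index set is absolute for real terms. At a diagonal point
  every monomial is a power of one number, so this single point yields a majorant for all
  \<open>h\<close> with \<open>norm h \<le> s\<close>.\<close>

lemma power_series_abs_summable:
  fixes c :: "('n::finite \<Rightarrow> nat) \<Rightarrow> real"
  assumes "has_power_series_at f c a"
  obtains s where "s > 0" "(\<lambda>k. s ^ deg k * \<bar>c k\<bar>) summable_on UNIV"
    "\<And>h. norm h \<le> s \<Longrightarrow> ((\<lambda>k. monomial k h * c k) has_sum f (a + h)) UNIV"
proof -
  obtain r where r: "r > 0" "\<And>h. h \<in> cube r \<Longrightarrow> ((\<lambda>k. monomial k h * c k) has_sum f (a + h)) UNIV"
    using assms unfolding has_power_series_at_def real_scaleR_def by blast
  have "(\<chi> i. r/2) \<in> (cube r :: (real ^ 'n) set)" using r(1) by (simp add: cube_def)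
  from has_sum_imp_summable[OF r(2)[OF this]] have "(\<lambda>k. (r/2) ^ deg k * c k) summable_on UNIV"
    unfolding monomial_const .
  then have "(\<lambda>k. norm ((r/2) ^ deg k * c k)) summable_on UNIV"
    by (rule summable_on_iff_abs_summable_on_real[THEN iffD1])
  then have "(\<lambda>k. (r/2) ^ deg k * \<bar>c k\<bar>) summable_on UNIV"
    using r(1) by (simp add: abs_mult)
  moreover have "h \<in> cube r" if "norm h \<le> r/2" for h :: "real ^ 'n"
    using that r(1) by (intro norm_less_imp_mem_cube) linarith
  ultimately show thesis using r by (intro that[of "r/2"]) simp_all
qed

text \<open>Unlike \<open>taylor_trunc\<close>, it takes the coefficients as an argument, so it can
  serve before their uniqueness is known and for expansions at any centre.\<close>

definition poly_part :: "nat \<Rightarrow> (('n::finite \<Rightarrow> nat) \<Rightarrow> real) \<Rightarrow> real ^ 'n \<Rightarrow> real" where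
  "poly_part N c h = (\<Sum>k | deg k \<le> N. monomial k h * c k)"

text \<open>Sum the Lipschitz bounds of the monomials of degree above \<open>N\<close>. With
  \<open>h' = 0\<close> the remainder is seen to have order \<open>N + 1\<close>; with
  \<open>h'\<close> near \<open>h\<close> its derivative is controlled without differentiating the
  series term by term.\<close>

lemma power_series_tail:
  fixes c :: "('n::finite \<Rightarrow> nat) \<Rightarrow> real"
  assumes "has_power_series_at f c a"
  obtains C s where "s > 0" "C \<ge> 0" "f a = poly_part N c 0"
    "\<And>\<rho> h h'. \<lbrakk>0 \<le> \<rho>; \<rho> \<le> s; norm h \<le> \<rho>; norm h' \<le> \<rho>\<rbrakk> \<Longrightarrow>
      \<bar>(f (a + h) - poly_part N c h) - (f (a + h') - poly_part N c h')\<bar> \<le> C * \<rho> ^ N * norm (h - h')"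
proof -
  obtain s where s: "s > 0" "(\<lambda>k. s ^ deg k * \<bar>c k\<bar>) summable_on UNIV"
    "\<And>h. norm h \<le> s \<Longrightarrow> ((\<lambda>k. monomial k h * c k) has_sum f (a + h)) UNIV"
    using power_series_abs_summable[OF assms] by blast
  define T where "T = {k :: 'n \<Rightarrow> nat. deg k > N}"
  define W where "W = (\<Sum>\<^sub>\<infinity>k\<in>T. s ^ deg k * \<bar>c k\<bar>)"
  have W: "((\<lambda>k. s ^ deg k * \<bar>c k\<bar>) has_sum W) T"
    unfolding W_def using s(2) by (meson has_sum_infsum subset_UNIV summable_on_subset_banach)
  have W0: "W \<ge> 0" unfolding W_def using s(1) by (intro infsum_nonneg) auto
  have T_eq: "T = UNIV - {k. deg k \<le> N}" by (auto simp: T_def)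
  have tail: "((\<lambda>k. monomial k h * c k) has_sum (f (a + h) - poly_part N c h)) T" if "norm h \<le> s" for h
    unfolding T_eq poly_part_def
    using that by (intro has_sum_Diff s(3) has_sum_finite finite_deg_le) auto
  \<comment> \<open>Every monomial of the tail has positive degree and vanishes at 0.\<close>
  have "((\<lambda>k. 0) has_sum (f (a + 0) - poly_part N c 0)) T"
    using s(1) by (intro has_sum_cong[THEN iffD1, OF _ tail]) (auto simp: T_def monomial_zero)
  then have f0: "f a = poly_part N c 0"
    using has_sum_unique[OF _ has_sum_0, of "\<lambda>_. 0" T "f a - poly_part N c 0"] by simp
  have bound: "\<bar>(f (a + h) - poly_part N c h) - (f (a + h') - poly_part N c h')\<bar>
      \<le> (2 / s) ^ (N + 1) * W * \<rho> ^ N * norm (h - h')"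
    if \<rho>: "0 \<le> \<rho>" "\<rho> \<le> s/2" "norm h \<le> \<rho>" "norm h' \<le> \<rho>" for \<rho> and h h' :: "real ^ 'n"
  proof -
    have 1: "((\<lambda>k. (monomial k h - monomial k h') * c k) has_sum
        ((f (a + h) - poly_part N c h) - (f (a + h') - poly_part N c h'))) T"
      using has_sum_add[OF tail has_sum_uminusI[OF tail], of h h'] \<rho> s(1)
      by (simp add: algebra_simps)
    have 2: "norm ((monomial k h - monomial k h') * c k)
        \<le> ((2 / s) ^ (N + 1) * \<rho> ^ N * norm (h - h')) * (s ^ deg k * \<bar>c k\<bar>)" if "k \<in> T" for k
    proof -
      obtain m where m: "deg k = N + 1 + m"
        using \<open>k \<in> T\<close> less_imp_Suc_add[of N "deg k"] by (auto simp: T_def)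
      have "real (deg k) * \<rho> ^ (deg k - 1) = \<rho> ^ N * (real (deg k) * \<rho> ^ m)"
        unfolding m by (simp add: power_add)
      \<comment> \<open>The factor \<open>deg k\<close> from the Lipschitz constant is absorbed by
        \<open>deg k < 2 ^ deg k\<close>; the price is the smaller radius
        \<open>s/2\<close>.\<close>
      also have "\<dots> \<le> \<rho> ^ N * (2 ^ deg k * (s/2) ^ m)"
        using \<rho> s(1) of_nat_less_two_power[of "deg k", where 'a = real]
        by (intro mult_left_mono mult_mono power_mono) auto
      also have "\<dots> = \<rho> ^ N * ((2 / s) ^ (N + 1) * s ^ deg k)"
        unfolding m using s(1) by (simp add: power_add power_divide)
      finally have "real (deg k) * \<rho> ^ (deg k - 1) * norm (h - h') * \<bar>c k\<bar>
          \<le> \<rho> ^ N * ((2 / s) ^ (N + 1) * s ^ deg k) * norm (h - h') * \<bar>c k\<bar>"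
        by (intro mult_right_mono) auto
      moreover have "norm ((monomial k h - monomial k h') * c k)
          \<le> real (deg k) * \<rho> ^ (deg k - 1) * norm (h - h') * \<bar>c k\<bar>"
        using monomial_Lipschitz[OF \<rho>(3,4), of k] by (simp add: abs_mult mult_right_mono)
      ultimately show ?thesis by (simp add: mult_ac)
    qed
    have "norm ((f (a + h) - poly_part N c h) - (f (a + h') - poly_part N c h'))
        \<le> ((2 / s) ^ (N + 1) * \<rho> ^ N * norm (h - h')) * W"
      by (rule norm_infsum_le[OF 1 has_sum_cmult_right[OF W] 2])
    then show ?thesis by (simp add: mult_ac)
  qed
  show thesis
    by (rule that[of "s/2", OF _ _ f0 bound]) (use s(1) W0 in auto)
qed

text \<open>Written with monomials again, so that the generator maps a polynomial to a sum of
  monomials times components of \<open>F\<close>. Where \<open>k i = 0\<close> the truncated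
  subtraction is harmless, as the factor \<open>real (k i)\<close> vanishes.\<close>

lemma monomial_has_derivative:
  "(monomial k has_derivative (\<lambda>v. \<Sum>i\<in>UNIV. v $ i * (real (k i) * monomial (k(i := k i - 1)) x))) (at x)"
proof -
  have upd: "monomial (k(i := k i - 1)) x = (x $ i) ^ (k i - 1) * (\<Prod>j\<in>UNIV - {i}. (x $ j) ^ k j)" for i
    unfolding monomial_def by (subst prod.remove[of UNIV i]) auto
  have "((\<lambda>x. \<Prod>i\<in>UNIV. (x $ i) ^ k i) has_derivative
      (\<lambda>v. \<Sum>i\<in>UNIV. (of_nat (k i) * v $ i * (x $ i) ^ (k i - 1)) * (\<Prod>j\<in>UNIV - {i}. (x $ j) ^ k j))) (at x)"
    by (intro has_derivative_prod has_derivative_power bounded_linear.has_derivative[OF bounded_linear_vec_nth]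
        has_derivative_ident)
  then show ?thesis
    unfolding upd unfolding monomial_def[abs_def] by (simp add: mult_ac)
qed

lemma poly_part_has_derivative:
  "(poly_part N c has_derivative
     (\<lambda>v. \<Sum>k | deg k \<le> N. (\<Sum>i\<in>UNIV. v $ i * (real (k i) * monomial (k(i := k i - 1)) x)) * c k)) (at x)"
  unfolding poly_part_def[abs_def]
  by (intro has_derivative_sum has_derivative_mult_left monomial_has_derivative)

lemma power_series_remainder_bigo:
  fixes c :: "('n::finite \<Rightarrow> nat) \<Rightarrow> real"
  assumes "has_power_series_at f c a"
  shows "(\<lambda>h. f (a + h) - poly_part N c h) \<in> O[nhds 0](\<lambda>h. norm h ^ (N + 1))"
proof -
  obtain C s where "s > 0" and f0: "f a = poly_part N c 0" and
    C: "\<And>\<rho> h h'. \<lbrakk>0 \<le> \<rho>; \<rho> \<le> s; norm h \<le> \<rho>; norm h' \<le> \<rho>\<rbrakk> \<Longrightarrow>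
      \<bar>(f (a + h) - poly_part N c h) - (f (a + h') - poly_part N c h')\<bar> \<le> C * \<rho> ^ N * norm (h - h')"
    using power_series_tail[OF assms, of N] by metis
  have near: "\<forall>\<^sub>F h :: real ^ 'n in nhds 0. dist h 0 < s"
    using \<open>s > 0\<close> eventually_nhds_metric by blast
  show ?thesis
  proof (rule bigoI[of _ C], rule eventually_mono[OF near])
    fix h :: "real ^ 'n"
    assume "dist h 0 < s"
    then show "norm (f (a + h) - poly_part N c h) \<le> C * norm (norm h ^ (N + 1))"
      using C[of "norm h" h 0] f0 by (simp add: mult_ac)
  qed
qed

text \<open>The remainder beyond degree 1 is quadratically small, hence has derivative 0 at the
  centre; the polynomial part is differentiable everywhere.\<close>

lemma power_series_differentiable:
  fixes c :: "('n::finite \<Rightarrow> nat) \<Rightarrow> real"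
  assumes "has_power_series_at f c a"
  shows "f differentiable at a"
proof -
  define T where "T h = f (a + h) - poly_part 1 c h" for h
  obtain C s where "s > 0" and f0: "f a = poly_part 1 c 0" and
    C: "\<And>\<rho> h h'. \<lbrakk>0 \<le> \<rho>; \<rho> \<le> s; norm h \<le> \<rho>; norm h' \<le> \<rho>\<rbrakk> \<Longrightarrow>
      \<bar>(f (a + h) - poly_part 1 c h) - (f (a + h') - poly_part 1 c h')\<bar> \<le> C * \<rho> ^ 1 * norm (h - h')"
    using power_series_tail[OF assms, of 1] by metis
  have "(T has_derivative (\<lambda>_. 0)) (at 0)"
  proof (rule has_derivativeI_sandwich[OF \<open>s > 0\<close>])
    show "((\<lambda>h. C * norm h) \<longlongrightarrow> 0) (at (0 :: real ^ 'n))"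
      by (auto intro!: tendsto_eq_intros)
    fix h :: "real ^ 'n"
    assume "h \<noteq> 0" "dist h 0 < s"
    then show "norm (T h - T 0 - 0) / norm (h - 0) \<le> C * norm h"
      using C[of "norm h" h 0] by (simp add: T_def divide_le_eq mult_ac)
  qed simp
  then have "T differentiable at (0 :: real ^ 'n)" "poly_part 1 c differentiable at 0"
    using poly_part_has_derivative differentiable_def by blast+
  then have "(\<lambda>h. T h + poly_part 1 c h) differentiable at (0 :: real ^ 'n)"
    by (rule differentiable_add)
  then have "(\<lambda>h. f (a + h)) differentiable at ((\<lambda>x. x - a) a)"
    by (simp add: T_def)
  then have "((\<lambda>h. f (a + h)) \<circ> (\<lambda>x. x - a)) differentiable at a"
    by (intro differentiable_chain_at) (auto intro!: derivative_intros)
  then show ?thesis by (simp add: o_def)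
qed

lemma real_analytic_on_differentiable:
  fixes f :: "real ^ 'n \<Rightarrow> real"
  assumes "real_analytic_on f A" "a \<in> A"
  shows "f differentiable at a"
  using assms power_series_differentiable unfolding real_analytic_on_def by blast

subsection \<open>Uniqueness of the Taylor coefficients\<close>

text \<open>Divide by the slowest power \<open>t powr \<alpha> m\<close> among the terms with
  nonzero coefficient. The quotient tends to \<open>e m\<close> because the exponents are distinct,
  and to 0 because \<open>\<alpha> m < \<beta>\<close>.\<close>

lemma powr_sum_bigo_imp_zero:
  fixes \<alpha> :: "'k \<Rightarrow> real"
  assumes "finite A" "inj_on \<alpha> A" "\<And>k. k \<in> A \<Longrightarrow> \<alpha> k < \<beta>"
    and bigo: "(\<lambda>t. \<Sum>k\<in>A. t powr \<alpha> k * e k) \<in> O[at_right 0](\<lambda>t. t powr \<beta>)"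
    and "k \<in> A"
  shows "e k = 0"
proof (rule ccontr)
  assume "e k \<noteq> 0"
  define B where "B = {k \<in> A. e k \<noteq> 0}"
  have B: "finite B" "B \<noteq> {}" using assms \<open>e k \<noteq> 0\<close> by (auto simp: B_def)
  define m where "m = arg_min_on \<alpha> B"
  have m: "m \<in> B" "\<And>j. j \<in> B \<Longrightarrow> \<alpha> m \<le> \<alpha> j"
    using arg_min_if_finite[OF B, of \<alpha>] by (auto simp: m_def not_less)
  have less: "\<alpha> m < \<alpha> j" if "j \<in> B" "j \<noteq> m" for j
    using m(2)[OF that(1)] inj_onD[OF assms(2), of m j] m(1) that by (fastforce simp: B_def)
  have powr0: "((\<lambda>t::real. t powr p) \<longlongrightarrow> 0) (at_right 0)" if "p > 0" for p
    using tendsto_powr'[of "\<lambda>t. t" 0 "at_right 0" "\<lambda>_. p" p] that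
    by (auto simp: eventually_at_right_less intro!: tendsto_eq_intros eventually_at_right_less[THEN eventually_mono])
  have "((\<lambda>t. \<Sum>j\<in>B. t powr (\<alpha> j - \<alpha> m) * e j) \<longlongrightarrow> (\<Sum>j\<in>B. if j = m then e m else 0)) (at_right 0)"
  proof (rule tendsto_sum)
    fix j assume "j \<in> B"
    show "((\<lambda>t. t powr (\<alpha> j - \<alpha> m) * e j) \<longlongrightarrow> (if j = m then e m else 0)) (at_right 0)"
    proof (cases "j = m")
      case True
      then show ?thesis
        by (auto intro!: tendsto_eventually eventually_at_right_less[THEN eventually_mono])
    next
      case False
      then show ?thesis
        using tendsto_mult_right[OF powr0, of "\<alpha> j - \<alpha> m" "e j"] less[OF \<open>j \<in> B\<close>] by simp
    qed
  qed
  then have lim: "((\<lambda>t. \<Sum>j\<in>B. t powr (\<alpha> j - \<alpha> m) * e j) \<longlongrightarrow> e m) (at_right 0)"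
    using B(1) m(1) by simp
  obtain C where C: "\<forall>\<^sub>F t in at_right 0. norm (\<Sum>k\<in>A. t powr \<alpha> k * e k) \<le> C * norm (t powr \<beta>)"
    using bigo by (elim landau_o.bigE)
  have "\<forall>\<^sub>F t in at_right 0. norm (\<Sum>j\<in>B. t powr (\<alpha> j - \<alpha> m) * e j) \<le> C * t powr (\<beta> - \<alpha> m)"
    using C eventually_at_right_less[of 0]
  proof eventually_elim
    case (elim t)
    have "(\<Sum>j\<in>B. t powr (\<alpha> j - \<alpha> m) * e j) = (\<Sum>j\<in>A. t powr \<alpha> j * e j) / t powr \<alpha> m"
      unfolding sum_divide_distrib using assms(1)
      by (intro sum.mono_neutral_cong_left) (auto simp: B_def powr_diff)
    then show ?case
      using elim by (simp add: powr_diff abs_div_pos divide_right_mono flip: abs_div_pos)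
  qed
  moreover have "((\<lambda>t. C * t powr (\<beta> - \<alpha> m)) \<longlongrightarrow> 0) (at_right 0)"
    using tendsto_mult_left[OF powr0, of "\<beta> - \<alpha> m" C] assms(3)[of m] m(1) by (simp add: B_def)
  ultimately have "((\<lambda>t. \<Sum>j\<in>B. t powr (\<alpha> j - \<alpha> m) * e j) \<longlongrightarrow> 0) (at_right 0)"
    by (rule Lim_null_comparison)
  then have "e m = 0"
    using tendsto_unique[OF _ lim] by simp
  then show False using m(1) by (simp add: B_def)
qed

text \<open>A generic weight vector separates finitely many exponents, since each coincidence
  confines it to a hyperplane. Along \<open>t \<mapsto> (t powr w\<^sub>i)\<^sub>i\<close> distinct monomials then vanish at distinct
  rates.\<close>
lemma exists_separating_weights:
  fixes A :: "('n::finite \<Rightarrow> nat) set"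
  assumes "finite A" "\<epsilon> > 0"
  obtains w :: "real ^ 'n" where "\<And>i. 1 \<le> w $ i" "\<And>i. w $ i \<le> 1 + \<epsilon>"
    "inj_on (\<lambda>k. \<Sum>i\<in>UNIV. w $ i * real (k i)) A"
proof -
  define H where "H k k' = {w :: real ^ 'n. (\<chi> i. real (k i) - real (k' i)) \<bullet> w = 0}" for k k'
  define U where "U = (\<Union>(k, k')\<in>{(k, k') \<in> A \<times> A. k \<noteq> k'}. H k k')"
  have "finite {(k, k') \<in> A \<times> A. k \<noteq> k'}"
    using assms(1) by (intro finite_subset[OF _ finite_cartesian_product[of A A]]) auto
  then have "negligible U" unfolding U_def
  proof (intro negligible_Union finite_imageI ballI)
    fix t assume "t \<in> (\<lambda>(k, k'). H k k') ` {(k, k') \<in> A \<times> A. k \<noteq> k'}"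
    then obtain k k' where t: "t = H k k'" "k \<noteq> k'" by auto
    then have "(\<chi> i. real (k i) - real (k' i)) \<noteq> 0"
      by (auto simp: vec_eq_iff fun_eq_iff)
    then show "negligible t" unfolding t H_def by (intro negligible_hyperplane) simp
  qed
  \<comment> \<open>The box of admissible weights has positive volume, so a null set cannot cover
    it.\<close>
  moreover have "\<not> negligible (cbox (\<chi> i. 1) (\<chi> i. 1 + \<epsilon>) :: (real ^ 'n) set)"
    using assms(2) by (auto simp: negligible_interval interval_eq_empty_cart not_le)
  ultimately have "\<not> cbox (\<chi> i. 1) (\<chi> i. 1 + \<epsilon>) \<subseteq> U"
    using negligible_subset by blast
  then obtain w where w: "w \<in> cbox (\<chi> i. 1) (\<chi> i. 1 + \<epsilon>)" "w \<notin> U" by blast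
  have "inj_on (\<lambda>k. \<Sum>i\<in>UNIV. w $ i * real (k i)) A"
  proof (rule inj_onI, rule ccontr)
    fix k k' assume *: "k \<in> A" "k' \<in> A" "(\<Sum>i\<in>UNIV. w $ i * real (k i)) = (\<Sum>i\<in>UNIV. w $ i * real (k' i))" "k \<noteq> k'"
    then have "w \<in> H k k'" by (simp add: H_def inner_vec_def algebra_simps sum_subtractf)
    then show False using * w(2) by (auto simp: U_def)
  qed
  then show thesis using that[of w] w(1) by (simp add: mem_box_cart)
qed

text \<open>Restrict to a curve \<open>t powr w $ i\<close> with separating weights slightly above
  1. Weights of at least 1 keep \<open>norm (h t)\<close> of order \<open>t\<close>, so the bound
  becomes \<open>t powr (N + 1)\<close>; weights close to 1 keep every exponent that occurs below
  \<open>N + 1\<close>.\<close>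

lemma poly_part_bigo_imp_zero:
  fixes e :: "('n::finite \<Rightarrow> nat) \<Rightarrow> real"
  assumes "poly_part N e \<in> O[nhds 0](\<lambda>h. norm h ^ (N + 1))" "deg k \<le> N"
  shows "e k = 0"
proof -
  \<comment> \<open>Chosen so that \<open>(1 + \<epsilon>) * N < N + 1\<close>.\<close>
  define \<epsilon> where "\<epsilon> = 1 / (real N + 1)"
  obtain w :: "real ^ 'n" where w: "\<And>i. 1 \<le> w $ i" "\<And>i. w $ i \<le> 1 + \<epsilon>"
    "inj_on (\<lambda>k. \<Sum>i\<in>UNIV. w $ i * real (k i)) {k. deg k \<le> N}"
    using exists_separating_weights[OF finite_deg_le, of \<epsilon> N] by (auto simp: \<epsilon>_def)
  define h :: "real \<Rightarrow> real ^ 'n" where "h t = (\<chi> i. t powr (w $ i))" for t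
  have h: "norm (h t) \<le> real CARD('n) * t" if "0 < t" "t \<le> 1" for t
  proof -
    have "norm (h t) \<le> (\<Sum>i\<in>UNIV. \<bar>h t $ i\<bar>)" by (rule norm_le_l1_cart)
    also have "\<dots> \<le> (\<Sum>i\<in>(UNIV :: 'n set). t)"
      using that w(1) powr_mono'[of 1 "w $ i" t for i] by (intro sum_mono) (simp add: h_def)
    finally show ?thesis by simp
  qed
  have small: "\<forall>\<^sub>F t :: real in at_right 0. 0 < t \<and> t \<le> 1"
    using eventually_at_right_real[of 0 1] by (auto elim: eventually_mono)
  have "((\<lambda>t. real CARD('n) * t) \<longlongrightarrow> 0) (at_right 0)"
    by (auto intro!: tendsto_eq_intros)
  then have "(h \<longlongrightarrow> 0) (at_right 0)"
    by (rule Lim_null_comparison[rotated]) (use small h in \<open>auto elim: eventually_mono\<close>)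
  from landau_o.big.compose[OF assms(1) this]
  have "(\<lambda>t. poly_part N e (h t)) \<in> O[at_right 0](\<lambda>t. norm (h t) ^ (N + 1))" .
  also have "(\<lambda>t. norm (h t) ^ (N + 1)) \<in> O[at_right 0](\<lambda>t. t powr (N + 1))"
  proof (intro bigoI[of _ "real CARD('n) ^ (N + 1)"] eventually_mono[OF small])
    fix t :: real assume t: "0 < t \<and> t \<le> 1"
    then have "norm (h t) ^ (N + 1) \<le> (real CARD('n) * t) ^ (N + 1)"
      using h by (intro power_mono) auto
    also have "\<dots> = real CARD('n) ^ (N + 1) * t powr (N + 1)"
      using t by (simp only: power_mult_distrib powr_realpow)
    finally show "norm (norm (h t) ^ (N + 1)) \<le> real CARD('n) ^ (N + 1) * norm (t powr (N + 1))"
      by simp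
  qed
  finally have "(\<lambda>t. poly_part N e (h t)) \<in> O[at_right 0](\<lambda>t. t powr (N + 1))" .
  also have "?this \<longleftrightarrow> (\<lambda>t. \<Sum>k | deg k \<le> N. t powr (\<Sum>i\<in>UNIV. w $ i * real (k i)) * e k)
      \<in> O[at_right 0](\<lambda>t. t powr (N + 1))"
  proof (rule landau_o.big.in_cong, rule eventually_mono[OF small])
    fix t :: real assume t: "0 < t \<and> t \<le> 1"
    have "monomial k (h t) = t powr (\<Sum>i\<in>UNIV. w $ i * real (k i))" for k
      using t by (simp add: monomial_def h_def powr_sum powr_powr flip: powr_realpow)
    then show "poly_part N e (h t) = (\<Sum>k | deg k \<le> N. t powr (\<Sum>i\<in>UNIV. w $ i * real (k i)) * e k)"
      by (simp add: poly_part_def)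
  qed
  finally have bigo: "(\<lambda>t. \<Sum>k | deg k \<le> N. t powr (\<Sum>i\<in>UNIV. w $ i * real (k i)) * e k)
      \<in> O[at_right 0](\<lambda>t. t powr (N + 1))" .
  show ?thesis
  proof (rule powr_sum_bigo_imp_zero[OF finite_deg_le w(3) _ bigo])
    show "k \<in> {k. deg k \<le> N}" using assms(2) by simp
    fix k :: "'n \<Rightarrow> nat" assume "k \<in> {k. deg k \<le> N}"
    then have k: "real (deg k) \<le> N" by (simp only: mem_Collect_eq of_nat_le_iff)
    have "(\<Sum>i\<in>UNIV. w $ i * real (k i)) \<le> (\<Sum>i\<in>UNIV. (1 + \<epsilon>) * real (k i))"
      by (intro sum_mono mult_right_mono w) auto
    also have "\<dots> = (1 + \<epsilon>) * real (deg k)" by (simp add: sum_distrib_left)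
    also have "\<dots> \<le> (1 + \<epsilon>) * N" using k by (intro mult_left_mono) (auto simp: \<epsilon>_def)
    also have "\<dots> < N + 1" by (simp add: \<epsilon>_def field_simps)
    finally show "(\<Sum>i\<in>UNIV. w $ i * real (k i)) < real (N + 1)" by simp
  qed
qed

section \<open>Coefficients of real and complex expansions\<close>

lemma has_power_series_at_linear:
  assumes "bounded_linear T" "has_power_series_at f c a"
  shows "has_power_series_at (\<lambda>x. T (f x)) (\<lambda>k. T (c k)) a"
proof -
  interpret bounded_linear T by fact
  show ?thesis
    using assms(2) has_sum_bounded_linear[OF assms(1)] unfolding has_power_series_at_def scaleR[symmetric]
    by blast
qed

text \<open>Cut both expansions at the degree of the coefficient in question: the two polynomial
  parts differ by less than that order can see. This gives the definite description in
  \<open>taylor_coeffs\<close> its meaning.\<close>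

lemma has_power_series_at_unique_real:
  fixes c d :: "('n::finite \<Rightarrow> nat) \<Rightarrow> real"
  assumes "has_power_series_at f c a" "has_power_series_at f d a"
  shows "c = d"
proof
  fix k :: "'n \<Rightarrow> nat"
  have "(\<lambda>h. (f (a + h) - poly_part (deg k) d h) - (f (a + h) - poly_part (deg k) c h))
      \<in> O[nhds 0](\<lambda>h. norm h ^ (deg k + 1))"
    by (intro sum_in_bigo power_series_remainder_bigo assms)
  then have "poly_part (deg k) (\<lambda>k. c k - d k) \<in> O[nhds 0](\<lambda>h. norm h ^ (deg k + 1))"
    by (simp add: poly_part_def[abs_def] right_diff_distrib sum_subtractf)
  from poly_part_bigo_imp_zero[OF this] show "c k = d k" by simp
qed

lemma has_power_series_at_unique_complex:
  fixes c d :: "('n::finite \<Rightarrow> nat) \<Rightarrow> complex"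
  assumes "has_power_series_at f c a" "has_power_series_at f d a"
  shows "c = d"
proof -
  have "(\<lambda>k. T (c k)) = (\<lambda>k. T (d k))" if "bounded_linear T" for T :: "complex \<Rightarrow> real"
    using assms[THEN has_power_series_at_linear[OF that]] by (rule has_power_series_at_unique_real)
  from this[OF bounded_linear_Re] this[OF bounded_linear_Im]
  show ?thesis by (simp add: fun_eq_iff complex_eq_iff)
qed

lemma taylor_coeffs_real:
  fixes c :: "('n::finite \<Rightarrow> nat) \<Rightarrow> real"
  assumes "has_power_series_at f c 0"
  shows "taylor_coeffs f = c"
  unfolding taylor_coeffs_def
  by (rule the_equality, rule assms, erule has_power_series_at_unique_real, rule assms)

lemma taylor_coeffs_complex:
  fixes c :: "('n::finite \<Rightarrow> nat) \<Rightarrow> complex"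
  assumes "has_power_series_at f c 0"
  shows "taylor_coeffs f = c"
  unfolding taylor_coeffs_def
  by (rule the_equality, rule assms, erule has_power_series_at_unique_complex, rule assms)

lemma taylor_trunc_poly_part:
  fixes c :: "('n::finite \<Rightarrow> nat) \<Rightarrow> real"
  assumes "has_power_series_at f c 0"
  shows "taylor_trunc N f = poly_part N c"
  by (simp add: taylor_trunc_def poly_part_def taylor_coeffs_real[OF assms] fun_eq_iff)

text \<open>Links the truncation of a complex eigenfunction, used in \<open>trunc_bound\<close>,
  with those of its real and imaginary parts, used in \<open>generator_remainder\<close>.\<close>

lemma taylor_trunc_Complex:
  fixes f :: "real ^ 'n \<Rightarrow> complex"
  assumes "real_analytic_on f {0}"
  shows "taylor_trunc N f x = Complex (taylor_trunc N (\<lambda>y. Re (f y)) x) (taylor_trunc N (\<lambda>y. Im (f y)) x)"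
proof -
  obtain c where c: "has_power_series_at f c 0" using assms by (auto simp: real_analytic_on_def)
  show ?thesis
    using taylor_trunc_poly_part[OF has_power_series_at_linear[OF bounded_linear_Re c], of N]
      taylor_trunc_poly_part[OF has_power_series_at_linear[OF bounded_linear_Im c], of N]
    by (simp add: complex_eq_iff taylor_trunc_def[of N f] taylor_coeffs_complex[OF c] poly_part_def)
qed

subsection \<open>The Koopman generator on Taylor truncations\<close>

lemma real_analytic_on_linear:
  assumes "bounded_linear T" "real_analytic_on f A"
  shows "real_analytic_on (\<lambda>x. T (f x)) A"
  using assms has_power_series_at_linear unfolding real_analytic_on_def by blast

lemma real_analytic_on_zero: "real_analytic_on (\<lambda>_. 0) A"
  unfolding real_analytic_on_def has_power_series_at_def
  by (intro ballI exI[of _ "\<lambda>_. 0"] exI[of _ 1]) (simp add: has_sum_0)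

lemma real_analytic_on_add:
  fixes f g :: "real ^ 'n \<Rightarrow> 'b::real_normed_vector"
  assumes "real_analytic_on f A" "real_analytic_on g A"
  shows "real_analytic_on (\<lambda>x. f x + g x) A"
  unfolding real_analytic_on_def
proof
  fix a assume "a \<in> A"
  then obtain c d where "has_power_series_at f c a" "has_power_series_at g d a"
    using assms unfolding real_analytic_on_def by blast
  then obtain r r' where "r > 0" "r' > 0"
    "\<And>h. h \<in> cube r \<Longrightarrow> ((\<lambda>k. monomial k h *\<^sub>R c k) has_sum f (a + h)) UNIV"
    "\<And>h. h \<in> cube r' \<Longrightarrow> ((\<lambda>k. monomial k h *\<^sub>R d k) has_sum g (a + h)) UNIV"
    unfolding has_power_series_at_def by blast
  moreover have "h \<in> cube r" "h \<in> cube r'" if "h \<in> cube (min r r')" for h :: "real ^ 'n"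
    using that by (auto simp: cube_def)
  ultimately have "has_power_series_at (\<lambda>x. f x + g x) (\<lambda>k. c k + d k) a"
    unfolding has_power_series_at_def scaleR_add_right
    by (intro exI[of _ "min r r'"] conjI ballI has_sum_add) auto
  then show "\<exists>c. has_power_series_at (\<lambda>x. f x + g x) c a" by blast
qed

lemma real_analytic_on_sum:
  assumes "\<And>j. j \<in> J \<Longrightarrow> real_analytic_on (f j) A"
  shows "real_analytic_on (\<lambda>x. \<Sum>j\<in>J. f j x) A"
  using assms by (induction J rule: infinite_finite_induct) (simp_all add: real_analytic_on_zero real_analytic_on_add)

text \<open>For expansions at the origin, multiplication by a monomial merely shifts the exponents,
  so no general product of series is involved.\<close>

lemma real_analytic_at_0_monomial_mult:
  fixes f :: "real ^ 'n \<Rightarrow> real"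
  assumes "real_analytic_on f {0}"
  shows "real_analytic_on (\<lambda>x. monomial m x * f x) {0}"
proof -
  obtain c where "has_power_series_at f c 0" using assms by (auto simp: real_analytic_on_def)
  then obtain r where r: "r > 0" "\<And>h. h \<in> cube r \<Longrightarrow> ((\<lambda>k. monomial k h * c k) has_sum f h) UNIV"
    unfolding has_power_series_at_def add_0 real_scaleR_def by blast
  define shift where "shift k = (\<lambda>i. k i + m i)" for k :: "'n \<Rightarrow> nat"
  \<comment> \<open>On the range of \<open>shift\<close> the subtraction \<open>k i - m i\<close> is
    exact; all other exponents get coefficient 0.\<close>
  define d where "d k = (if k \<in> range shift then c (\<lambda>i. k i - m i) else 0)" for k
  have inj: "inj shift" by (auto simp: inj_on_def shift_def fun_eq_iff)
  have d: "d (shift k) = c k" for k by (simp add: d_def shift_def)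
  have mon: "monomial (shift k) h = monomial m h * monomial k h" for k and h :: "real ^ 'n"
    by (simp add: monomial_def shift_def power_add mult.commute flip: prod.distrib)
  have "((\<lambda>k. monomial k h * d k) has_sum (monomial m h * f h)) UNIV" if "h \<in> cube r" for h
  proof -
    have "((\<lambda>k. monomial m h * (monomial k h * c k)) has_sum (monomial m h * f h)) UNIV"
      by (intro has_sum_cmult_right r that)
    also have "(\<lambda>k. monomial m h * (monomial k h * c k)) = (\<lambda>k. monomial k h * d k) \<circ> shift"
      by (simp add: fun_eq_iff d mon mult.assoc)
    finally have "((\<lambda>k. monomial k h * d k) has_sum (monomial m h * f h)) (range shift)"
      by (simp only: has_sum_reindex[OF inj])
    then show ?thesis
      by (rule has_sum_cong_neutral[THEN iffD1, rotated 3]) (auto simp: d_def)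
  qed
  then have "has_power_series_at (\<lambda>x. monomial m x * f x) d 0"
    unfolding has_power_series_at_def using r(1) by auto
  then show ?thesis by (auto simp: real_analytic_on_def)
qed

section \<open>The generator applied to polynomials and Taylor remainders\<close>

lemma koopman_generator_eq:
  "(f has_derivative D) (at x) \<Longrightarrow> koopman_generator F f x = D (F x)"
  unfolding koopman_generator_def by (metis frechet_derivative_at)

text \<open>Provides the expansion at the origin that the outer truncation in
  \<open>P_N L P_N\<close> refers to.\<close>

lemma koopman_poly_part_analytic:
  fixes F :: "real ^ 'n \<Rightarrow> real ^ 'n"
  assumes "real_analytic_on F {0}"
  shows "real_analytic_on (koopman_generator F (poly_part N c)) {0}"
proof -
  have "koopman_generator F (poly_part N c) = (\<lambda>x. \<Sum>k | deg k \<le> N. \<Sum>i\<in>UNIV.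
      (monomial (k(i := k i - 1)) x * F x $ i) * (real (k i) * c k))"
    by (simp add: fun_eq_iff koopman_generator_eq[OF poly_part_has_derivative] sum_distrib_right sum_distrib_left mult_ac)
  moreover have "real_analytic_on (\<lambda>x. F x $ i) {0}" for i
    using assms real_analytic_on_linear bounded_linear_vec_nth by blast
  ultimately show ?thesis
    by (auto intro!: real_analytic_on_sum real_analytic_on_linear[OF bounded_linear_mult_left]
        real_analytic_at_0_monomial_mult)
qed

text \<open>The difference quotients along \<open>x + t *\<^sub>R v\<close> obey the bound, and so
  does their limit. Only increments based at \<open>x\<close> enter.\<close>

lemma derivative_bound_of_Lipschitz:
  fixes g :: "'a::real_normed_vector \<Rightarrow> real"
  assumes "(g has_derivative D) (at x)"
    and "\<forall>\<^sub>F y in nhds x. \<bar>g y - g x\<bar> \<le> L * norm (y - x)"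
  shows "\<bar>D v\<bar> \<le> L * norm v"
proof -
  interpret bounded_linear D using assms(1) by (rule has_derivative_bounded_linear)
  have "((\<lambda>t. x + t *\<^sub>R v) has_derivative (\<lambda>t. t *\<^sub>R v)) (at (0::real))"
    by (auto intro!: derivative_eq_intros)
  then have "((\<lambda>t. g (x + t *\<^sub>R v)) has_derivative (\<lambda>t. D (t *\<^sub>R v))) (at 0)"
    by (rule has_derivative_compose) (simp add: assms(1))
  then have "((\<lambda>t. g (x + t *\<^sub>R v)) has_field_derivative D v) (at 0)"
    unfolding has_field_derivative_def by (simp add: scaleR mult_commute_abs)
  then have "((\<lambda>t. \<bar>(g (x + t *\<^sub>R v) - g x) / t\<bar>) \<longlongrightarrow> \<bar>D v\<bar>) (at 0)"
    by (intro tendsto_rabs) (simp add: DERIV_def)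
  moreover have "((\<lambda>t. x + t *\<^sub>R v) \<longlongrightarrow> x) (at (0::real))"
    by (auto intro!: tendsto_eq_intros)
  from eventually_compose_filterlim[OF assms(2) this]
  have "\<forall>\<^sub>F t in at 0. \<bar>(g (x + t *\<^sub>R v) - g x) / t\<bar> \<le> L * norm v"
    using eventually_neq_at_within[of "0::real"]
    by eventually_elim (simp add: divide_le_eq mult_ac)
  ultimately show ?thesis by (rule tendsto_upperbound) simp
qed

text \<open>The remainder of order \<open>N + 1\<close> is Lipschitz with constant of order \<open>N\<close>, and the factor \<open>F\<close>,
  which vanishes at the equilibrium, makes up for the order lost by differentiation.\<close>
lemma koopman_remainder_bigo:
  fixes F :: "real ^ 'n \<Rightarrow> real ^ 'n" and f :: "real ^ 'n \<Rightarrow> real"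
  assumes "has_power_series_at f c 0"
    and "\<forall>\<^sub>F h in nhds 0. f differentiable at h"
    and "\<forall>\<^sub>F h in nhds 0. norm (F h) \<le> B * norm h"
  shows "(\<lambda>h. koopman_generator F f h - koopman_generator F (poly_part N c) h)
    \<in> O[nhds 0](\<lambda>h. norm h ^ (N + 1))"
proof -
  define q where "q h = f h - poly_part N c h" for h
  obtain C s where "s > 0" "C \<ge> 0" and
    C: "\<And>\<rho> h h'. \<lbrakk>0 \<le> \<rho>; \<rho> \<le> s; norm h \<le> \<rho>; norm h' \<le> \<rho>\<rbrakk> \<Longrightarrow>
      \<bar>q h - q h'\<bar> \<le> C * \<rho> ^ N * norm (h - h')"
    unfolding q_def using power_series_tail[OF assms(1), of N] by (metis add_0)
  have near: "\<forall>\<^sub>F h :: real ^ 'n in nhds 0. dist h 0 < s/2"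
    using \<open>s > 0\<close> eventually_nhds_metric half_gt_zero by blast
  have "\<forall>\<^sub>F h in nhds 0. norm (koopman_generator F f h - koopman_generator F (poly_part N c) h)
      \<le> (C * 2 ^ N * B) * norm (norm h ^ (N + 1))"
    using near assms(2,3)
  proof eventually_elim
    case (elim h)
    then obtain D where D: "(f has_derivative D) (at h)" by (auto simp: differentiable_def)
    obtain E where E: "(poly_part N c has_derivative E) (at h)" using poly_part_has_derivative by blast
    have qD: "(q has_derivative (\<lambda>v. D v - E v)) (at h)"
      unfolding q_def[abs_def] using D E by (rule has_derivative_diff)
    interpret bounded_linear "\<lambda>v. D v - E v" using qD by (rule has_derivative_bounded_linear)
    have "\<bar>D (F h) - E (F h)\<bar> \<le> (C * 2 ^ N * B) * norm h ^ (N + 1)"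
    proof (cases "h = 0")
      case True
      then show ?thesis using elim zero by simp
    next
      case False
      \<comment> \<open>Such \<open>y\<close> have norm at most \<open>2 * norm h\<close>, which
        stays below \<open>s\<close> since \<open>norm h < s/2\<close>. This is the source of the
        factor \<open>2 ^ N\<close>.\<close>
      then have "\<forall>\<^sub>F y in nhds h. dist y h < norm h"
        using eventually_nhds_metric zero_less_norm_iff by blast
      then have "\<forall>\<^sub>F y in nhds h. \<bar>q y - q h\<bar> \<le> (C * (2 * norm h) ^ N) * norm (y - h)"
      proof eventually_elim
        case (elim y)
        have "norm y \<le> 2 * norm h"
          using elim norm_triangle_sub[of y h] by (simp add: dist_norm)
        then show ?case using C[of "2 * norm h" y h] \<open>dist h 0 < s/2\<close> by simp
      qed
      from derivative_bound_of_Lipschitz[OF qD this]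
      have "\<bar>D (F h) - E (F h)\<bar> \<le> (C * (2 * norm h) ^ N) * norm (F h)" .
      also have "\<dots> \<le> (C * (2 * norm h) ^ N) * (B * norm h)"
        using elim \<open>C \<ge> 0\<close> by (intro mult_left_mono) auto
      finally show ?thesis by (simp add: power_mult_distrib mult_ac)
    qed
    then show ?case
      by (simp add: koopman_generator_eq[OF D] koopman_generator_eq[OF E])
  qed
  then show ?thesis by (rule bigoI)
qed

text \<open>Differentiability is available for real-valued analytic functions, so the derivative of
  \<open>f\<close> is assembled from those of its two parts. This splits the complex eigenvalue
  equation into a real system.\<close>

lemma koopman_generator_Re_Im:
  fixes f :: "real ^ 'n \<Rightarrow> complex"
  assumes "real_analytic_on f A" "x \<in> A"
  shows "koopman_generator F (\<lambda>y. Re (f y)) x = Re (koopman_generator F f x)"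
    and "koopman_generator F (\<lambda>y. Im (f y)) x = Im (koopman_generator F f x)"
proof -
  have "(\<lambda>y. Re (f y)) differentiable at x" "(\<lambda>y. Im (f y)) differentiable at x"
    using assms real_analytic_on_linear[OF bounded_linear_Re assms(1)]
      real_analytic_on_linear[OF bounded_linear_Im assms(1)] real_analytic_on_differentiable by blast+
  then obtain D E where D: "((\<lambda>y. Re (f y)) has_derivative D) (at x)"
    and E: "((\<lambda>y. Im (f y)) has_derivative E) (at x)"
    by (auto simp: differentiable_def)
  have "((\<lambda>y. complex_of_real (Re (f y)) + \<i> * complex_of_real (Im (f y))) has_derivative
      (\<lambda>v. complex_of_real (D v) + \<i> * complex_of_real (E v))) (at x)"
    by (intro derivative_intros D E)
  then have "(f has_derivative (\<lambda>v. complex_of_real (D v) + \<i> * complex_of_real (E v))) (at x)"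
    by (simp flip: complex_eq)
  then show "koopman_generator F (\<lambda>y. Re (f y)) x = Re (koopman_generator F f x)"
    "koopman_generator F (\<lambda>y. Im (f y)) x = Im (koopman_generator F f x)"
    by (simp_all add: koopman_generator_eq[OF D] koopman_generator_eq[OF E] koopman_generator_eq)
qed

text \<open>The identity \<open>P\<^sub>N L P\<^sub>N u = P\<^sub>N L u\<close> for \<open>L u = a u + b v\<close> near an equilibrium: both sides are polynomials
  of degree at most \<open>N\<close> that agree to order \<open>N + 1\<close>.\<close>
lemma taylor_trunc_koopman_taylor_trunc:
  fixes F :: "real ^ 'n \<Rightarrow> real ^ 'n" and u v :: "real ^ 'n \<Rightarrow> real"
  assumes "real_analytic_on F {0}" "real_analytic_on u {0}" "real_analytic_on v {0}"
    and "\<forall>\<^sub>F h in nhds 0. u differentiable at h"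
    and "\<forall>\<^sub>F h in nhds 0. norm (F h) \<le> B * norm h"
    and "\<forall>\<^sub>F h in nhds 0. koopman_generator F u h = a * u h + b * v h"
  shows "taylor_trunc N (koopman_generator F (taylor_trunc N u)) x
    = a * taylor_trunc N u x + b * taylor_trunc N v x"
proof -
  let ?O = "O[nhds 0](\<lambda>h :: real ^ 'n. norm h ^ (N + 1))"
  obtain c d where c: "has_power_series_at u c 0" and d: "has_power_series_at v d 0"
    using assms(2,3) by (auto simp: real_analytic_on_def)
  define w where "w = koopman_generator F (poly_part N c)"
  obtain e where e: "has_power_series_at w e 0"
    using koopman_poly_part_analytic[OF assms(1), of N c] by (auto simp: real_analytic_on_def w_def)
  have u: "(\<lambda>h. u h - poly_part N c h) \<in> ?O" and v: "(\<lambda>h. v h - poly_part N d h) \<in> ?O"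
    and w: "(\<lambda>h. w h - poly_part N e h) \<in> ?O"
    using power_series_remainder_bigo[OF c, of N] power_series_remainder_bigo[OF d, of N]
      power_series_remainder_bigo[OF e, of N] by simp_all
  have scaled: "(\<lambda>h. r * g h) \<in> ?O" if "g \<in> ?O" for r g
    using that by (cases "r = 0") simp_all
  have "(\<lambda>h. koopman_generator F u h - w h) \<in> ?O"
    unfolding w_def by (rule koopman_remainder_bigo[OF c assms(4,5)])
  also have "?this \<longleftrightarrow> (\<lambda>h. a * u h + b * v h - w h) \<in> ?O"
    using assms(6) by (intro landau_o.big.in_cong) (auto elim: eventually_mono)
  \<comment> \<open>In this combination \<open>u\<close>, \<open>v\<close> and \<open>w\<close>
    cancel, leaving a polynomial of degree at most \<open>N\<close> that is small of order
    \<open>N + 1\<close>.\<close>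
  finally have "(\<lambda>h. (a * u h + b * v h - w h) + (w h - poly_part N e h)
      - (a * (u h - poly_part N c h) + b * (v h - poly_part N d h))) \<in> ?O"
    by (intro sum_in_bigo(2)[OF sum_in_bigo(1)[OF _ w] sum_in_bigo(1)] scaled u v)
  also have "(\<lambda>h. (a * u h + b * v h - w h) + (w h - poly_part N e h)
      - (a * (u h - poly_part N c h) + b * (v h - poly_part N d h)))
      = poly_part N (\<lambda>k. a * c k + b * d k - e k)"
    by (simp add: fun_eq_iff poly_part_def algebra_simps sum.distrib sum_subtractf sum_distrib_left)
  finally have "e k = a * c k + b * d k" if "deg k \<le> N" for k
    using poly_part_bigo_imp_zero that by fastforce
  then have "poly_part N e x = a * poly_part N c x + b * poly_part N d x"
    by (simp add: poly_part_def algebra_simps sum.distrib sum_distrib_left)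
  then show ?thesis
    using taylor_trunc_poly_part[OF e] by (simp add: taylor_trunc_poly_part[OF c] taylor_trunc_poly_part[OF d] w_def)
qed

section \<open>Derivatives of the two candidate functions and their comparison\<close>

lemma taylor_trunc_differentiable:
  fixes f :: "real ^ 'n \<Rightarrow> real"
  assumes "real_analytic_on f {0}"
  shows "taylor_trunc N f differentiable at x"
proof -
  obtain c where c: "has_power_series_at f c 0" using assms by (auto simp: real_analytic_on_def)
  show ?thesis
    unfolding taylor_trunc_poly_part[OF c] differentiable_def using poly_part_has_derivative by blast
qed

text \<open>Splitting the squared modulus into real squares avoids differentiating
  \<open>cmod\<close>. Serves both for the eigenfunctions and for their truncations.\<close>

lemma koopman_generator_sum_sq:
  fixes f :: "'n::finite \<Rightarrow> real ^ 'm \<Rightarrow> complex"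
  assumes "\<And>i. (\<lambda>y. Re (f i y)) differentiable at x" "\<And>i. (\<lambda>y. Im (f i y)) differentiable at x"
  shows "koopman_generator F (sum_sq f) x = 2 * (\<Sum>i\<in>UNIV.
    Re (f i x) * koopman_generator F (\<lambda>y. Re (f i y)) x + Im (f i x) * koopman_generator F (\<lambda>y. Im (f i y)) x)"
proof -
  obtain D E where D: "\<And>i. ((\<lambda>y. Re (f i y)) has_derivative D i) (at x)"
    and E: "\<And>i. ((\<lambda>y. Im (f i y)) has_derivative E i) (at x)"
    using assms unfolding differentiable_def by metis
  have "((\<lambda>y. \<Sum>i\<in>UNIV. (Re (f i y))\<^sup>2 + (Im (f i y))\<^sup>2) has_derivative
      (\<lambda>v. \<Sum>i\<in>UNIV. of_nat 2 * D i v * Re (f i x) ^ (2 - 1) + of_nat 2 * E i v * Im (f i x) ^ (2 - 1))) (at x)"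
    by (intro has_derivative_sum has_derivative_add has_derivative_power D E)
  then have "(sum_sq f has_derivative
      (\<lambda>v. \<Sum>i\<in>UNIV. 2 * Re (f i x) * D i v + 2 * Im (f i x) * E i v)) (at x)"
    by (simp add: sum_sq_def[abs_def] cmod_power2 mult_ac)
  from koopman_generator_eq[OF this] show ?thesis
    by (simp add: koopman_generator_eq[OF D] koopman_generator_eq[OF E] sum_distrib_left algebra_simps)
qed

text \<open>Factor the difference of squares and apply the triangle inequality to each factor; this
  is where the shape of \<open>trunc_bound\<close> comes from.\<close>

lemma abs_cmod_power2_diff_le:
  "\<bar>(cmod z)\<^sup>2 - (cmod p)\<^sup>2\<bar> \<le> 2 * cmod p * cmod (z - p) + (cmod (z - p))\<^sup>2"
proof -
  have "\<bar>cmod z - cmod p\<bar> \<le> cmod (z - p)" by (rule norm_triangle_ineq3)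
  moreover have "cmod z + cmod p \<le> 2 * cmod p + cmod (z - p)"
    using norm_triangle_sub[of z p] by simp
  ultimately have "\<bar>cmod z - cmod p\<bar> * (cmod z + cmod p) \<le> cmod (z - p) * (2 * cmod p + cmod (z - p))"
    by (intro mult_mono) auto
  moreover have "\<bar>(cmod z)\<^sup>2 - (cmod p)\<^sup>2\<bar> = \<bar>cmod z - cmod p\<bar> * (cmod z + cmod p)"
    by (simp add: abs_mult power2_eq_square square_diff_square_factored mult.commute)
  ultimately show ?thesis by (simp add: power2_eq_square algebra_simps)
qed

text \<open>Stated at a single point \<open>x\<close>, with the bounds \<open>M i\<close> and
  \<open>K i\<close> required there only. Strictness is drawn from the gap between a truncation and
  its bound, which counts only when multiplied by a nonzero remainder.\<close>

theorem proposition4: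
  fixes X :: "(real ^ 'n) set"
    and F :: "real ^ 'n \<Rightarrow> real ^ 'n"
    and flow :: "real \<Rightarrow> real ^ 'n \<Rightarrow> real ^ 'n"
    and lam :: "'n \<Rightarrow> complex"
    and phi :: "'n \<Rightarrow> real ^ 'n \<Rightarrow> complex"
    and S :: real and N :: nat
    and M K :: "'n \<Rightarrow> real"
    and x :: "real ^ 'n"
  assumes "compact X" and "0 \<in> interior X"
    and "real_analytic_on F X" and "\<exists>C. C-lipschitz_on X F"
    and "semiflow_on X F flow"
    and "F 0 = 0"
    and "eigenvalues_of (jacobian F (at 0)) lam"
    and "\<forall>i. Re (lam i) < 0"
    and "nonresonant lam"
    and "S > 0"
    and "\<forall>i. real_analytic_on (phi i) (cube S)"
    and "\<forall>i. \<exists>y\<in>X. phi i y \<noteq> 0"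
    and "\<forall>i. \<forall>y\<in>X \<inter> cube S. koopman_generator F (phi i) y = lam i * phi i y"
    and "\<forall>i. M i > 0" and "\<forall>i. K i > 0"
    and "x \<in> X \<inter> cube S"
    and "\<forall>i. \<bar>taylor_trunc N (\<lambda>y. Re (phi i y)) x\<bar> < M i"
    and "\<forall>i. \<bar>taylor_trunc N (\<lambda>y. Im (phi i y)) x\<bar> < K i"
  shows "let V = sum_sq phi;
             V' = sum_sq (\<lambda>i. taylor_trunc N (phi i));
             lhs = \<bar>koopman_generator F V x - koopman_generator F V' x\<bar>;
             R = (\<lambda>i. generator_remainder N F (\<lambda>y. Re (phi i y)) x);
             Q = (\<lambda>i. generator_remainder N F (\<lambda>y. Im (phi i y)) x);
             rhs = 2 * (\<Sum>i\<in>UNIV. \<bar>Re (lam i)\<bar> * trunc_bound N (phi i) x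
                                  + M i * \<bar>R i\<bar> + K i * \<bar>Q i\<bar>)
         in lhs \<le> rhs \<and> ((\<exists>i. R i \<noteq> 0 \<or> Q i \<noteq> 0) \<longrightarrow> lhs < rhs)"
proof -
  let ?L = "koopman_generator F" and ?P = "taylor_trunc N"
  define u where "u i y = Re (phi i y)" for i y
  define v where "v i y = Im (phi i y)" for i y
  define R where "R i = generator_remainder N F (u i) x" for i
  define Q where "Q i = generator_remainder N F (v i) x" for i
  have "0 \<in> X" using assms(2) interior_subset by blast
  have "0 \<in> (cube S :: (real ^ 'n) set)" using \<open>S > 0\<close> by (simp add: cube_def)
  have phi: "real_analytic_on (phi i) (cube S)" for i using assms(11) by blast
  then have uv: "real_analytic_on (u i) (cube S)" "real_analytic_on (v i) (cube S)" for i
    unfolding u_def[abs_def] v_def[abs_def]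
    by (auto intro: real_analytic_on_linear bounded_linear_Re bounded_linear_Im)
  have at_0: "real_analytic_on (phi i) {0}" "real_analytic_on (u i) {0}" "real_analytic_on (v i) {0}"
    "real_analytic_on F {0}" for i
    using phi[of i] uv[of i] assms(3) \<open>0 \<in> X\<close> \<open>0 \<in> cube S\<close> by (auto simp: real_analytic_on_def)
  \<comment> \<open>The origin is interior to both the cube and \<open>X\<close>, so what holds on
    their intersection holds eventually in \<open>nhds 0\<close>.\<close>
  have near_cube: "\<forall>\<^sub>F h :: real ^ 'n in nhds 0. h \<in> cube S"
    using open_cube \<open>0 \<in> cube S\<close> by (rule eventually_nhds_in_open)
  have near_X: "\<forall>\<^sub>F h in nhds 0. h \<in> X"
    using eventually_nhds_in_open[OF open_interior assms(2)]
    by (rule eventually_mono) (use interior_subset in blast)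
  have diff: "u i differentiable at y" "v i differentiable at y" if "y \<in> cube S" for i y
    using uv that real_analytic_on_differentiable by blast+
  have Luv: "?L (u i) y = Re (lam i) * u i y + (- Im (lam i)) * v i y"
    "?L (v i) y = Re (lam i) * v i y + Im (lam i) * u i y" if "y \<in> X" "y \<in> cube S" for i y
    using koopman_generator_Re_Im[OF phi that(2)] assms(13) that
    by (simp_all add: u_def[abs_def] v_def[abs_def])
  obtain B where "B-lipschitz_on X F" using assms(4) by blast
  then have F: "\<forall>\<^sub>F h in nhds 0. norm (F h) \<le> B * norm h"
    using near_X lipschitz_onD[of B X F _ 0] \<open>0 \<in> X\<close> \<open>F 0 = 0\<close> by (auto elim!: eventually_mono)
  have near_diff: "\<forall>\<^sub>F h in nhds 0. u i differentiable at h" "\<forall>\<^sub>F h in nhds 0. v i differentiable at h" for i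
    using near_cube by (eventually_elim, simp add: diff)+
  have near_Luv: "\<forall>\<^sub>F h in nhds 0. ?L (u i) h = Re (lam i) * u i h + (- Im (lam i)) * v i h"
    "\<forall>\<^sub>F h in nhds 0. ?L (v i) h = Re (lam i) * v i h + Im (lam i) * u i h" for i
    by (rule eventually_mono[OF eventually_conj[OF near_X near_cube]]; simp only: Luv)+
  \<comment> \<open>The second instance exchanges \<open>u\<close> and \<open>v\<close> and reverses
    the sign of \<open>Im (lam i)\<close>.\<close>
  note Pu = taylor_trunc_koopman_taylor_trunc[OF at_0(4) at_0(2,3) near_diff(1) F near_Luv(1)]
  note Pv = taylor_trunc_koopman_taylor_trunc[OF at_0(4) at_0(3,2) near_diff(2) F near_Luv(2)]
  have P: "?P (phi i) y = Complex (?P (u i) y) (?P (v i) y)" for i y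
    using taylor_trunc_Complex[OF at_0(1)] by (simp add: u_def[abs_def] v_def[abs_def])
  have P_diff: "?P (u i) differentiable at x" "?P (v i) differentiable at x" for i
    using taylor_trunc_differentiable at_0(2,3) by blast+
  \<comment> \<open>The cross terms with \<open>Im (lam i)\<close> cancel, so only the real part of
    the eigenvalue survives.\<close>
  have V: "?L (sum_sq phi) x = 2 * (\<Sum>i\<in>UNIV. Re (lam i) * (cmod (phi i x))\<^sup>2)"
  proof -
    have "?L (sum_sq phi) x = 2 * (\<Sum>i\<in>UNIV. u i x * ?L (u i) x + v i x * ?L (v i) x)"
      using assms(16) diff unfolding u_def[abs_def] v_def[abs_def] by (intro koopman_generator_sum_sq) auto
    moreover have "u i x * ?L (u i) x + v i x * ?L (v i) x = Re (lam i) * (cmod (phi i x))\<^sup>2" for i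
      using assms(16) by (simp add: Luv cmod_power2 flip: u_def v_def) (simp add: power2_eq_square algebra_simps)
    ultimately show ?thesis by (simp only:)
  qed
  \<comment> \<open>The same cancellation takes place in the truncated part; \<open>L P_N\<close> is
    \<open>P_N L P_N\<close> minus the remainder, hence the minus signs.\<close>
  have V': "?L (sum_sq (\<lambda>i. ?P (phi i))) x
      = 2 * (\<Sum>i\<in>UNIV. Re (lam i) * (cmod (?P (phi i) x))\<^sup>2 - ?P (u i) x * R i - ?P (v i) x * Q i)"
  proof -
    have "?L (sum_sq (\<lambda>i. ?P (phi i))) x = 2 * (\<Sum>i\<in>UNIV. Re (?P (phi i) x) * ?L (\<lambda>y. Re (?P (phi i) y)) x
        + Im (?P (phi i) x) * ?L (\<lambda>y. Im (?P (phi i) y)) x)"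
      by (intro koopman_generator_sum_sq) (simp_all add: P P_diff)
    moreover have "Re (?P (phi i) x) * ?L (\<lambda>y. Re (?P (phi i) y)) x + Im (?P (phi i) x) * ?L (\<lambda>y. Im (?P (phi i) y)) x
        = Re (lam i) * (cmod (?P (phi i) x))\<^sup>2 - ?P (u i) x * R i - ?P (v i) x * Q i" for i
      by (simp add: P R_def Q_def generator_remainder_def Pu Pv cmod_power2)
        (simp add: power2_eq_square algebra_simps)
    ultimately show ?thesis by (simp only:)
  qed
  \<comment> \<open>Half the contribution of index \<open>i\<close> to the difference of the two
    derivatives.\<close>
  define T where "T i = Re (lam i) * ((cmod (phi i x))\<^sup>2 - (cmod (?P (phi i) x))\<^sup>2)
    + ?P (u i) x * R i + ?P (v i) x * Q i" for i
  define b where "b i = \<bar>Re (lam i)\<bar> * trunc_bound N (phi i) x + M i * \<bar>R i\<bar> + K i * \<bar>Q i\<bar>" for i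
  have small: "\<bar>?P (u i) x\<bar> < M i" "\<bar>?P (v i) x\<bar> < K i" for i
    using assms(17,18) by (simp_all add: u_def[abs_def] v_def[abs_def])
  have T_le: "\<bar>T i\<bar> \<le> \<bar>Re (lam i)\<bar> * trunc_bound N (phi i) x
      + \<bar>?P (u i) x\<bar> * \<bar>R i\<bar> + \<bar>?P (v i) x\<bar> * \<bar>Q i\<bar>" for i
  proof -
    have "\<bar>Re (lam i) * ((cmod (phi i x))\<^sup>2 - (cmod (?P (phi i) x))\<^sup>2)\<bar>
        \<le> \<bar>Re (lam i)\<bar> * trunc_bound N (phi i) x"
      unfolding abs_mult trunc_bound_def by (intro mult_left_mono abs_cmod_power2_diff_le) simp
    moreover have "\<bar>T i\<bar> \<le> \<bar>Re (lam i) * ((cmod (phi i x))\<^sup>2 - (cmod (?P (phi i) x))\<^sup>2)\<bar>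
        + \<bar>?P (u i) x * R i\<bar> + \<bar>?P (v i) x * Q i\<bar>"
      unfolding T_def by linarith
    ultimately show ?thesis by (simp add: abs_mult)
  qed
  have RQ_le: "\<bar>?P (u i) x\<bar> * \<bar>R i\<bar> \<le> M i * \<bar>R i\<bar>" "\<bar>?P (v i) x\<bar> * \<bar>Q i\<bar> \<le> K i * \<bar>Q i\<bar>" for i
    using small[of i] by (intro mult_right_mono; simp)+
  have T_le_b: "\<bar>T i\<bar> \<le> b i" for i
    using T_le[of i] RQ_le[of i] unfolding b_def by linarith
  have T_less_b: "\<bar>T i\<bar> < b i" if "R i \<noteq> 0 \<or> Q i \<noteq> 0" for i
  proof -
    have "\<bar>?P (u i) x\<bar> * \<bar>R i\<bar> < M i * \<bar>R i\<bar> \<or> \<bar>?P (v i) x\<bar> * \<bar>Q i\<bar> < K i * \<bar>Q i\<bar>"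
      using that small[of i] by auto
    then show ?thesis using T_le[of i] RQ_le[of i] unfolding b_def by linarith
  qed
  have "?L (sum_sq phi) x - ?L (sum_sq (\<lambda>i. ?P (phi i))) x = 2 * (\<Sum>i\<in>UNIV. T i)"
    unfolding V V' T_def by (simp add: sum.distrib sum_subtractf algebra_simps)
  then have lhs: "\<bar>?L (sum_sq phi) x - ?L (sum_sq (\<lambda>i. ?P (phi i))) x\<bar> \<le> 2 * (\<Sum>i\<in>UNIV. \<bar>T i\<bar>)"
    using sum_abs[of T UNIV] by (simp add: abs_mult)
  have le: "(\<Sum>i\<in>UNIV. \<bar>T i\<bar>) \<le> (\<Sum>i\<in>UNIV. b i)"
    by (intro sum_mono T_le_b)
  \<comment> \<open>One index with a strict inequality suffices, as the others satisfy the weak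
    one.\<close>
  have less: "(\<Sum>i\<in>UNIV. \<bar>T i\<bar>) < (\<Sum>i\<in>UNIV. b i)" if "\<exists>i. R i \<noteq> 0 \<or> Q i \<noteq> 0"
    using that T_le_b T_less_b by (intro sum_strict_mono_ex1) auto
  have R_eq: "generator_remainder N F (\<lambda>y. Re (phi i y)) x = R i"
    and Q_eq: "generator_remainder N F (\<lambda>y. Im (phi i y)) x = Q i" for i
    by (simp_all add: R_def Q_def u_def[abs_def] v_def[abs_def])
  show ?thesis
    unfolding Let_def R_eq Q_eq b_def[symmetric]
    by (intro conjI impI) (use lhs le in linarith, drule less, use lhs in linarith)
qed

end
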